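(* Let $\mathfrak g$ be a finite-dimensional real Lie algebra and $\mathfrak i\lhd\mathfrak g$ an ideal. If the Kuranishi map $\mathrm{Kur}_{\mathfrak i\lhd\mathfrak g}\colon H^0(\mathfrak i\lhd\mathfrak g)\to H^1(\mathfrak i\lhd\mathfrak g)$ is not identically zero, then the deformation problem of $\mathfrak i\lhd\mathfrak g$ is obstructed: there exists a cohomology class $[\eta]\in H^0(\mathfrak i\lhd\mathfrak g)$ that is not a deformation class, i.e. there exists no smooth deformation $(\mathfrak i_t)_{t\in I}$ of the ideal $\mathfrak i$ inside $\mathfrak g$ such that $\left.\frac{d}{dt}\right|_{t=0}\mathfrak i_t=\eta$.
   Context: Let $k=\dim\mathfrak i$ and let $\bar x$ be the class of $x$ in $\mathfrak g/\mathfrak i$. $H^\bullet(\mathfrak i\lhd\mathfrak g)$ is the cohomology of the Chevalley–Eilenberg complex $C^p(\mathfrak g;\mathfrak i^*\otimes\mathfrak g/\mathfrak i)=\wedge^p\mathfrak g^*\otimes\mathfrak i^*\otimes\mathfrak g/\mathfrak i$ of $\mathfrak g$ with values in the representation $\mathrm{ad}^{\mathrm{Hom}}_x(\phi)(u)=[\bar x,\phi(u)]-\phi([x,u])$ on $\mathrm{Hom}(\mathfrak i,\mathfrak g/\mathfrak i)$. Thus $H^0(\mathfrak i\lhd\mathfrak g)=\{\eta\in\mathrm{Hom}(\mathfrak i,\mathfrak g/\mathfrak i)\mid[\bar x,\eta(u)]=\eta([x,u])\ \forall x\in\mathfrak g,u\in\mathfrak i\}$. Fix a linear splitting $\sigma\colon\mathfrak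 g/\mathfrak i\to\mathfrak g$ of $\mathfrak g\to\mathfrak g/\mathfrak i$ and set $\mathrm{pr}_\sigma(x)=x-\sigma(\bar x)\in\mathfrak i$. The Kuranishi map is $\mathrm{Kur}_{\mathfrak i\lhd\mathfrak g}([\eta])=\frac12[m_2(\eta,\eta)]$, where for $\eta\in\mathrm{Hom}(\mathfrak i,\mathfrak g/\mathfrak i)$, $m_2(\eta,\eta)\in C^1(\mathfrak g;\mathfrak i^*\otimes\mathfrak g/\mathfrak i)$ is $m_2(\eta,\eta)(x,u)=-2\eta(\mathrm{pr}_\sigma[x,\sigma(\eta(u))])$; it is a cocycle when $\eta$ is. A smooth deformation $(\mathfrak i_t)_{t\in I}$ of the ideal $\mathfrak i$ is a smooth curve $I=[0,1]\to\mathrm{Gr}_k(\mathfrak g)$ with $\mathfrak i_0=\mathfrak i$ and each $\mathfrak i_t$ an ideal of $\mathfrak g$. Its derivative at $0$ is an element of $T_{\mathfrak i}\mathrm{Gr}_k(\mathfrak g)\simeq\mathfrak i^*\otimes\mathfrak g/\mathfrak i$: if $\mathfrak i_t=\mathrm{graph}(\phi(t))$ with $\phi(t)\in\mathrm{Hom}(\mathfrak i,\mathfrak i^c)$ for a complement $\mathfrak i^c$ of $\mathfrak i$, it is $\dot\phi(0)$ composed with the projection $\mathfrak g\to\mathfrak g/\mathfrak i$. *)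

theory Defs
  imports "HOL-Analysis.Analysis" "HOL-Library.Set_Algebras" "HOL-Library.FuncSet"
begin

section \<open>Lie algebras and ideals\<close>

definition lie_algebra :: "('g::real_vector \<Rightarrow> 'g \<Rightarrow> 'g) \<Rightarrow> bool" where
  "lie_algebra brk \<longleftrightarrow>
     (\<forall>x. linear (brk x)) \<and> (\<forall>y. linear (\<lambda>x. brk x y)) \<and>
     (\<forall>x. brk x x = 0) \<and>
     (\<forall>x y z. brk x (brk y z) + brk y (brk z x) + brk z (brk x y) = 0)"

definition lie_ideal :: "('g::real_vector \<Rightarrow> 'g \<Rightarrow> 'g) \<Rightarrow> 'g set \<Rightarrow> bool" where
  "lie_ideal brk I \<longleftrightarrow> subspace I \<and> (\<forall>x. \<forall>u\<in>I. brk x u \<in> I)"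


section \<open>The quotient by an ideal\<close>

text \<open>
  The elements of the quotient are the cosets \<open>x + I\<close>. Their sum is the elementwise sum of
  \<open>Set_Algebras\<close>. The summand \<open>I\<close> in the operations below makes the result a coset also in the
  degenerate cases (zero scalar, empty sum), and \<open>I\<close> itself is the zero vector of the quotient.
  The operator \<open>-\<close> on sets is set difference, so subtraction of cosets has a name of its own.
\<close>

definition cls :: "'g::real_vector set \<Rightarrow> 'g \<Rightarrow> 'g set" where
  "cls I x = {x + u |u. u \<in> I}"

definition quot :: "'g::real_vector set \<Rightarrow> 'g set set" where
  "quot I = range (cls I)"

definition qscale :: "'g::real_vector set \<Rightarrow> real \<Rightarrow> 'g set \<Rightarrow> 'g set" where
  "qscale I c X = {c *\<^sub>R x + u |x u. x \<in> X \<and> u \<in> I}"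

definition qdiff :: "'g::real_vector set \<Rightarrow> 'g set \<Rightarrow> 'g set" where
  "qdiff X Y = {x - y |x y. x \<in> X \<and> y \<in> Y}"

definition qsum :: "'g::real_vector set \<Rightarrow> ('j \<Rightarrow> 'g set) \<Rightarrow> 'j set \<Rightarrow> 'g set" where
  "qsum I F J = I + (\<Sum>j\<in>J. F j)"

definition qbrk ::
    "('g::real_vector \<Rightarrow> 'g \<Rightarrow> 'g) \<Rightarrow> 'g set \<Rightarrow> 'g set \<Rightarrow> 'g set \<Rightarrow> 'g set" where
  "qbrk brk I X Y = {brk x y + u |x y u. x \<in> X \<and> y \<in> Y \<and> u \<in> I}"


section \<open>The Chevalley--Eilenberg complex with values in Hom(I, g/I)\<close>

definition Hom_quot :: "'g::real_vector set \<Rightarrow> ('g \<Rightarrow> 'g set) set" where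
  "Hom_quot I = {\<phi> \<in> I \<rightarrow>\<^sub>E quot I.
     (\<forall>u\<in>I. \<forall>v\<in>I. \<phi> (u + v) = \<phi> u + \<phi> v) \<and>
     (\<forall>c. \<forall>u\<in>I. \<phi> (c *\<^sub>R u) = qscale I c (\<phi> u))}"

definition ad_Hom ::
    "('g::real_vector \<Rightarrow> 'g \<Rightarrow> 'g) \<Rightarrow> 'g set \<Rightarrow> 'g \<Rightarrow> ('g \<Rightarrow> 'g set) \<Rightarrow> 'g \<Rightarrow> 'g set" where
  "ad_Hom brk I x \<phi> = (\<lambda>u\<in>I. qdiff (qbrk brk I (cls I x) (\<phi> u)) (\<phi> (brk x u)))"

text \<open>
  A \<open>p\<close>-cochain takes its \<open>p\<close> arguments in \<open>g\<close> as a list of length \<open>p\<close>; cochains are extensional,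
  so that equality of cochains is equality of functions.
\<close>

definition cochains :: "'g::real_vector set \<Rightarrow> nat \<Rightarrow> ('g list \<Rightarrow> 'g \<Rightarrow> 'g set) set" where
  "cochains I p = {\<omega> \<in> {xs. length xs = p} \<rightarrow>\<^sub>E Hom_quot I.
     (\<forall>xs j x y. length xs = p \<and> j < p \<longrightarrow>
        (\<forall>u\<in>I. \<omega> (xs[j := x + y]) u = \<omega> (xs[j := x]) u + \<omega> (xs[j := y]) u)) \<and>
     (\<forall>xs j c x. length xs = p \<and> j < p \<longrightarrow>
        (\<forall>u\<in>I. \<omega> (xs[j := c *\<^sub>R x]) u = qscale I c (\<omega> (xs[j := x]) u))) \<and>
     (\<forall>xs j k. length xs = p \<and> j < k \<and> k < p \<and> xs ! j = xs ! k \<longrightarrow>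
        (\<forall>u\<in>I. \<omega> xs u = I))}"

definition zero_cochain :: "'g::real_vector set \<Rightarrow> nat \<Rightarrow> 'g list \<Rightarrow> 'g \<Rightarrow> 'g set" where
  "zero_cochain I p = (\<lambda>xs\<in>{xs. length xs = p}. \<lambda>u\<in>I. I)"

definition scale_cochain ::
    "'g::real_vector set \<Rightarrow> nat \<Rightarrow> real \<Rightarrow> ('g list \<Rightarrow> 'g \<Rightarrow> 'g set) \<Rightarrow> 'g list \<Rightarrow> 'g \<Rightarrow> 'g set" where
  "scale_cochain I p c \<omega> = (\<lambda>xs\<in>{xs. length xs = p}. \<lambda>u\<in>I. qscale I c (\<omega> xs u))"

definition diff_cochain ::
    "'g::real_vector set \<Rightarrow> nat \<Rightarrow> ('g list \<Rightarrow> 'g \<Rightarrow> 'g set) \<Rightarrow> ('g list \<Rightarrow> 'g \<Rightarrow> 'g set) \<Rightarrow>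
       'g list \<Rightarrow> 'g \<Rightarrow> 'g set" where
  "diff_cochain I p \<omega> \<theta> = (\<lambda>xs\<in>{xs. length xs = p}. \<lambda>u\<in>I. qdiff (\<omega> xs u) (\<theta> xs u))"

definition omit :: "nat \<Rightarrow> 'a list \<Rightarrow> 'a list" where
  "omit j xs = take j xs @ drop (Suc j) xs"

text \<open>
  With arguments \<open>x\<^sub>0, \<dots>, x\<^sub>p\<close>, the differential is
  \<open>\<Sum>\<^sub>j (-1)\<^sup>j x\<^sub>j \<cdot> \<omega>(\<dots>, x\<^sub>j omitted, \<dots>)
   + \<Sum>\<^sub>j\<^sub><\<^sub>k (-1)\<^sup>j\<^sup>+\<^sup>k \<omega>([x\<^sub>j, x\<^sub>k], \<dots>, x\<^sub>j and x\<^sub>k omitted, \<dots>)\<close>.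
\<close>

definition CE_diff ::
    "('g::real_vector \<Rightarrow> 'g \<Rightarrow> 'g) \<Rightarrow> 'g set \<Rightarrow> nat \<Rightarrow> ('g list \<Rightarrow> 'g \<Rightarrow> 'g set) \<Rightarrow>
       'g list \<Rightarrow> 'g \<Rightarrow> 'g set" where
  "CE_diff brk I p \<omega> = (\<lambda>xs\<in>{xs. length xs = Suc p}. \<lambda>u\<in>I.
     qsum I (\<lambda>j. qscale I ((-1) ^ j) (ad_Hom brk I (xs ! j) (\<omega> (omit j xs)) u)) {..p} +
     qsum I (\<lambda>(j, k). qscale I ((-1) ^ (j + k))
                 (\<omega> (brk (xs ! j) (xs ! k) # omit j (omit k xs)) u))
       {(j, k). j < k \<and> k \<le> p})"

definition cocycles ::
    "('g::real_vector \<Rightarrow> 'g \<Rightarrow> 'g) \<Rightarrow> 'g set \<Rightarrow> nat \<Rightarrow> ('g list \<Rightarrow> 'g \<Rightarrow> 'g set) set" where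
  "cocycles brk I p = {\<omega> \<in> cochains I p. CE_diff brk I p \<omega> = zero_cochain I (Suc p)}"

definition coboundaries ::
    "('g::real_vector \<Rightarrow> 'g \<Rightarrow> 'g) \<Rightarrow> 'g set \<Rightarrow> nat \<Rightarrow> ('g list \<Rightarrow> 'g \<Rightarrow> 'g set) set" where
  "coboundaries brk I p =
     (case p of 0 \<Rightarrow> {zero_cochain I 0} | Suc q \<Rightarrow> CE_diff brk I q ` cochains I q)"

definition coh_class ::
    "('g::real_vector \<Rightarrow> 'g \<Rightarrow> 'g) \<Rightarrow> 'g set \<Rightarrow> nat \<Rightarrow> ('g list \<Rightarrow> 'g \<Rightarrow> 'g set) \<Rightarrow>
       ('g list \<Rightarrow> 'g \<Rightarrow> 'g set) set" where
  "coh_class brk I p \<omega> = {\<theta> \<in> cochains I p. diff_cochain I p \<theta> \<omega> \<in> coboundaries brk I p}"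

definition cohomology ::
    "('g::real_vector \<Rightarrow> 'g \<Rightarrow> 'g) \<Rightarrow> 'g set \<Rightarrow> nat \<Rightarrow> ('g list \<Rightarrow> 'g \<Rightarrow> 'g set) set set" where
  "cohomology brk I p = coh_class brk I p ` cocycles brk I p"

text \<open>
  Degree zero, under the identification of a 0-cochain with its value at the empty list; the
  lemma \<open>H0_iff_cocycle\<close> below relates the two descriptions.
\<close>

definition H0 :: "('g::real_vector \<Rightarrow> 'g \<Rightarrow> 'g) \<Rightarrow> 'g set \<Rightarrow> ('g \<Rightarrow> 'g set) set" where
  "H0 brk I = {\<eta> \<in> Hom_quot I. \<forall>x. \<forall>u\<in>I. qbrk brk I (cls I x) (\<eta> u) = \<eta> (brk x u)}"


section \<open>The Kuranishi map\<close>

definition linear_splitting :: "'g::real_vector set \<Rightarrow> ('g set \<Rightarrow> 'g) \<Rightarrow> bool" where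
  "linear_splitting I \<sigma> \<longleftrightarrow>
     (\<forall>X\<in>quot I. cls I (\<sigma> X) = X) \<and>
     (\<forall>X\<in>quot I. \<forall>Y\<in>quot I. \<sigma> (X + Y) = \<sigma> X + \<sigma> Y) \<and>
     (\<forall>c. \<forall>X\<in>quot I. \<sigma> (qscale I c X) = c *\<^sub>R \<sigma> X)"

definition pr :: "'g::real_vector set \<Rightarrow> ('g set \<Rightarrow> 'g) \<Rightarrow> 'g \<Rightarrow> 'g" where
  "pr I \<sigma> x = x - \<sigma> (cls I x)"

definition m2 ::
    "('g::real_vector \<Rightarrow> 'g \<Rightarrow> 'g) \<Rightarrow> 'g set \<Rightarrow> ('g set \<Rightarrow> 'g) \<Rightarrow> ('g \<Rightarrow> 'g set) \<Rightarrow>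
       'g list \<Rightarrow> 'g \<Rightarrow> 'g set" where
  "m2 brk I \<sigma> \<eta> = (\<lambda>xs\<in>{xs. length xs = 1}. \<lambda>u\<in>I.
     qscale I (- 2) (\<eta> (pr I \<sigma> (brk (xs ! 0) (\<sigma> (\<eta> u))))))"

definition Kur ::
    "('g::real_vector \<Rightarrow> 'g \<Rightarrow> 'g) \<Rightarrow> 'g set \<Rightarrow> ('g set \<Rightarrow> 'g) \<Rightarrow> ('g \<Rightarrow> 'g set) \<Rightarrow>
       ('g list \<Rightarrow> 'g \<Rightarrow> 'g set) set" where
  "Kur brk I \<sigma> \<eta> = coh_class brk I 1 (scale_cochain I 1 (1/2) (m2 brk I \<sigma> \<eta>))"


section \<open>Smooth deformations\<close>

definition Gr :: "nat \<Rightarrow> 'g::euclidean_space set set" where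
  "Gr k = {W. subspace W \<and> dim W = k}"

definition complementary :: "'g::real_vector set \<Rightarrow> 'g set \<Rightarrow> bool" where
  "complementary W C \<longleftrightarrow> subspace W \<and> subspace C \<and> W \<inter> C = {0} \<and> W + C = UNIV"

text \<open>
  All derivatives exist on \<open>S\<close>, one-sided where \<open>S\<close> is one-sided. It is only used for
  relatively open subsets of \<open>[0,1]\<close>, in which every point is a limit point.
\<close>

definition smooth_curve_on :: "real set \<Rightarrow> (real \<Rightarrow> 'g::real_normed_vector) \<Rightarrow> bool" where
  "smooth_curve_on S f \<longleftrightarrow> (\<exists>D. (\<forall>t\<in>S. D 0 t = f t) \<and>
     (\<forall>n. \<forall>t\<in>S. (D n has_vector_derivative D (Suc n) t) (at t within S)))"

text \<open>
  On \<open>S\<close>, the curve \<open>W\<close> in the Grassmannian is written in the standard chart at \<open>W t0\<close> given by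
  the complement \<open>C\<close>: \<open>W t\<close> is the graph of \<open>\<phi> t\<close> in \<open>Hom (W t0, C)\<close>. The linear map \<open>\<phi> t\<close> is
  total, but only its restriction to \<open>W t0\<close> is ever used.
\<close>

definition grassmann_chart ::
    "(real \<Rightarrow> 'g::euclidean_space set) \<Rightarrow> real \<Rightarrow> real set \<Rightarrow> 'g set \<Rightarrow> (real \<Rightarrow> 'g \<Rightarrow> 'g) \<Rightarrow> bool" where
  "grassmann_chart W t0 S C \<phi> \<longleftrightarrow>
     openin (top_of_set {0..1}) S \<and> t0 \<in> S \<and> complementary (W t0) C \<and>
     (\<forall>t\<in>S. linear (\<phi> t) \<and> \<phi> t ` W t0 \<subseteq> C \<and> W t = {u + \<phi> t u |u. u \<in> W t0})"

definition smooth_grassmann_curve :: "nat \<Rightarrow> (real \<Rightarrow> 'g::euclidean_space set) \<Rightarrow> bool" where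
  "smooth_grassmann_curve k W \<longleftrightarrow> (\<forall>t\<in>{0..1}. W t \<in> Gr k) \<and>
     (\<forall>t0\<in>{0..1}. \<exists>S C \<phi>. grassmann_chart W t0 S C \<phi> \<and>
        (\<forall>u\<in>W t0. smooth_curve_on S (\<lambda>t. \<phi> t u)))"

definition smooth_deformation ::
    "('g::euclidean_space \<Rightarrow> 'g \<Rightarrow> 'g) \<Rightarrow> 'g set \<Rightarrow> (real \<Rightarrow> 'g set) \<Rightarrow> bool" where
  "smooth_deformation brk I W \<longleftrightarrow>
     smooth_grassmann_curve (dim I) W \<and> W 0 = I \<and> (\<forall>t\<in>{0..1}. lie_ideal brk (W t))"

text \<open>
  The derivative at 0 in \<open>Hom (W 0, g / W 0)\<close>; it does not depend on the complement \<open>C\<close>.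
\<close>

definition has_derivative_at_0 ::
    "(real \<Rightarrow> 'g::euclidean_space set) \<Rightarrow> ('g \<Rightarrow> 'g set) \<Rightarrow> bool" where
  "has_derivative_at_0 W \<eta> \<longleftrightarrow> (\<exists>S C \<phi> v. grassmann_chart W 0 S C \<phi> \<and>
     (\<forall>u\<in>W 0. ((\<lambda>t. \<phi> t u) has_vector_derivative v u) (at 0 within {0..1})) \<and>
     \<eta> = (\<lambda>u\<in>W 0. cls (W 0) (v u)))"

definition deformation_class ::
    "('g::euclidean_space \<Rightarrow> 'g \<Rightarrow> 'g) \<Rightarrow> 'g set \<Rightarrow> ('g \<Rightarrow> 'g set) \<Rightarrow> bool" where
  "deformation_class brk I \<eta> \<longleftrightarrow>
     (\<exists>W. smooth_deformation brk I W \<and> has_derivative_at_0 W \<eta>)"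


section \<open>Consistency of the definitions\<close>

lemma lie_ideal_subspace: "lie_ideal brk I \<Longrightarrow> subspace I"
  by (simp add: lie_ideal_def)

lemma mem_cls: "z \<in> cls I x \<longleftrightarrow> z - x \<in> I"
  by (auto simp: cls_def intro: exI[of _ "z - x"])

lemma cls_eq_iff:
  assumes "subspace I" shows "cls I x = cls I y \<longleftrightarrow> x - y \<in> I"
proof
  assume "cls I x = cls I y"
  moreover have "x \<in> cls I x"
    using subspace_0[OF assms] by (simp add: mem_cls)
  ultimately show "x - y \<in> I" by (simp add: mem_cls)
next
  assume xy: "x - y \<in> I"
  have "z - x \<in> I \<longleftrightarrow> z - y \<in> I" for z
    using subspace_add[OF assms, of "z - x" "x - y"] subspace_diff[OF assms, of "z - y" "x - y"] xy
    by auto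
  then show "cls I x = cls I y" by (auto simp: mem_cls)
qed

lemma cls_0: "cls I 0 = I"
  by (simp add: cls_def)

lemma cls_eq_self:
  assumes "subspace I" shows "cls I x = I \<longleftrightarrow> x \<in> I"
  using cls_eq_iff[OF assms, of x 0] by (simp add: cls_0)

lemma cls_add:
  assumes "subspace I" shows "cls I x + cls I y = cls I (x + y)"
proof (intro equalityI subsetI)
  fix z assume "z \<in> cls I x + cls I y"
  then obtain u v where "u \<in> I" "v \<in> I" "z = (x + u) + (y + v)"
    by (auto simp: cls_def set_plus_def)
  then show "z \<in> cls I (x + y)"
    using subspace_add[OF assms, of u v] by (simp add: mem_cls algebra_simps)
next
  fix z assume "z \<in> cls I (x + y)"
  then have "z - y \<in> cls I x" "y \<in> cls I y"
    using subspace_0[OF assms] by (simp_all add: mem_cls algebra_simps)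
  then have "(z - y) + y \<in> cls I x + cls I y" by (rule set_plus_intro)
  then show "z \<in> cls I x + cls I y" by simp
qed

lemma cls_plus_self:
  assumes "subspace I" shows "cls I x + I = cls I x" "I + cls I x = cls I x"
  using cls_add[OF assms, of x 0] cls_add[OF assms, of 0 x] by (simp_all add: cls_0)

lemma qscale_cls:
  assumes "subspace I" shows "qscale I c (cls I x) = cls I (c *\<^sub>R x)"
proof (intro equalityI subsetI)
  fix z assume "z \<in> qscale I c (cls I x)"
  then obtain u v where "u \<in> I" "v \<in> I" "z = c *\<^sub>R (x + u) + v"
    by (auto simp: cls_def qscale_def)
  then show "z \<in> cls I (c *\<^sub>R x)"
    using subspace_add[OF assms subspace_scale[OF assms], of u v c]
    by (simp add: mem_cls algebra_simps)
next
  fix z assume "z \<in> cls I (c *\<^sub>R x)"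
  then have "z = c *\<^sub>R x + (z - c *\<^sub>R x)" "x \<in> cls I x" "z - c *\<^sub>R x \<in> I"
    using subspace_0[OF assms] by (simp_all add: mem_cls)
  then show "z \<in> qscale I c (cls I x)" unfolding qscale_def by blast
qed

lemma qdiff_cls:
  assumes "subspace I" shows "qdiff (cls I x) (cls I y) = cls I (x - y)"
proof (intro equalityI subsetI)
  fix z assume "z \<in> qdiff (cls I x) (cls I y)"
  then obtain u v where "u \<in> I" "v \<in> I" "z = (x + u) - (y + v)"
    by (auto simp: cls_def qdiff_def)
  then show "z \<in> cls I (x - y)"
    using subspace_diff[OF assms, of u v] by (simp add: mem_cls)
next
  fix z assume "z \<in> cls I (x - y)"
  then have "z = (z + y) - y" "z + y \<in> cls I x" "y \<in> cls I y"
    using subspace_0[OF assms] by (simp_all add: mem_cls algebra_simps)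
  then show "z \<in> qdiff (cls I x) (cls I y)" unfolding qdiff_def by blast
qed

lemma qbrk_cls:
  assumes L: "lie_algebra brk" and I: "lie_ideal brk I"
  shows "qbrk brk I (cls I x) (cls I y) = cls I (brk x y)"
proof -
  have S: "subspace I" using I by (rule lie_ideal_subspace)
  have r: "brk a (b + c) = brk a b + brk a c" and l: "brk (a + b) c = brk a c + brk b c" for a b c
    using L by (auto simp: lie_algebra_def linear_iff)
  have sq: "brk a a = 0" for a
    using L by (auto simp: lie_algebra_def)
  have ab: "brk a b + brk b a = 0" for a b
    using sq[of "a + b"] sq[of a] sq[of b] by (simp only: r l) (simp add: add.commute)
  have anti: "brk b a = - brk a b" for a b
    by (metis ab add_eq_0_iff)
  have i: "u \<in> I \<Longrightarrow> brk a u \<in> I" "u \<in> I \<Longrightarrow> brk u a \<in> I" for a u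
    using I anti[of u a] subspace_neg[OF S] by (auto simp: lie_ideal_def)
  show ?thesis
  proof (intro equalityI subsetI)
    fix z assume "z \<in> qbrk brk I (cls I x) (cls I y)"
    then obtain u v w where uvw: "u \<in> I" "v \<in> I" "w \<in> I" "z = brk (x + u) (y + v) + w"
      by (auto simp: cls_def qbrk_def)
    have "brk x v + brk u y + brk u v + w \<in> I"
      using uvw i by (intro subspace_add[OF S]) auto
    then show "z \<in> cls I (brk x y)"
      using uvw by (simp add: mem_cls r l algebra_simps)
  next
    fix z assume "z \<in> cls I (brk x y)"
    then have "z = brk x y + (z - brk x y)" "x \<in> cls I x" "y \<in> cls I y" "z - brk x y \<in> I"
      using subspace_0[OF S] by (simp_all add: mem_cls)
    then show "z \<in> qbrk brk I (cls I x) (cls I y)" unfolding qbrk_def by blast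
  qed
qed

lemma Hom_quot_obtain:
  assumes "\<phi> \<in> Hom_quot I"
  obtains f where "\<And>u. u \<in> I \<Longrightarrow> \<phi> u = cls I (f u)"
proof -
  have "\<forall>u\<in>I. \<exists>y. \<phi> u = cls I y"
    using assms by (auto simp: Hom_quot_def quot_def PiE_iff image_iff)
  then show ?thesis using that by metis
qed

lemma H0_iff_cocycle:
  assumes L: "lie_algebra brk" and I: "lie_ideal brk I"
  shows "\<eta> \<in> H0 brk I \<longleftrightarrow> (\<lambda>xs\<in>{xs. length xs = 0}. \<eta>) \<in> cocycles brk I 0"
proof -
  let ?w = "\<lambda>xs\<in>{xs::'a list. length xs = 0}. \<eta>"
  have S: "subspace I" using I by (rule lie_ideal_subspace)
  have C: "?w \<in> cochains I 0 \<longleftrightarrow> \<eta> \<in> Hom_quot I"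
    by (auto simp: cochains_def PiE_iff)
  show ?thesis
  proof (cases "\<eta> \<in> Hom_quot I")
    case True
    obtain f where f: "\<And>u. u \<in> I \<Longrightarrow> \<eta> u = cls I (f u)" using Hom_quot_obtain[OF True] by blast
    have i: "u \<in> I \<Longrightarrow> brk x u \<in> I" for x u using I by (auto simp: lie_ideal_def)
    have e: "{(j, k). j < k \<and> k = (0::nat)} = {}" by auto
    have D: "CE_diff brk I 0 ?w [x] u = cls I (brk x (f u) - f (brk x u))" if "u \<in> I" for x u
      using that
      by (simp add: CE_diff_def qsum_def e ad_Hom_def omit_def f i qbrk_cls[OF L I] qdiff_cls[OF S]
          qscale_cls[OF S] cls_plus_self[OF S])
    have "CE_diff brk I 0 ?w = zero_cochain I (Suc 0) \<longleftrightarrow>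
        (\<forall>x. \<forall>u\<in>I. CE_diff brk I 0 ?w [x] u = I)"
    proof
      assume "CE_diff brk I 0 ?w = zero_cochain I (Suc 0)"
      then show "\<forall>x. \<forall>u\<in>I. CE_diff brk I 0 ?w [x] u = I" by (simp add: zero_cochain_def)
    next
      assume a: "\<forall>x. \<forall>u\<in>I. CE_diff brk I 0 ?w [x] u = I"
      show "CE_diff brk I 0 ?w = zero_cochain I (Suc 0)"
      proof (intro ext)
        fix xs u
        show "CE_diff brk I 0 ?w xs u = zero_cochain I (Suc 0) xs u"
        proof (cases "length xs = Suc 0 \<and> u \<in> I")
          case True
          then obtain x where "xs = [x]" by (auto simp: length_Suc_conv)
          then show ?thesis using a True by (simp add: zero_cochain_def)
        next
          case False
          then show ?thesis by (auto simp: zero_cochain_def CE_diff_def)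
        qed
      qed
    qed
    also have "\<dots> \<longleftrightarrow> (\<forall>x. \<forall>u\<in>I. brk x (f u) - f (brk x u) \<in> I)"
      by (simp only: D cls_eq_self[OF S] cong: ball_cong)
    also have "\<dots> \<longleftrightarrow> (\<forall>x. \<forall>u\<in>I. qbrk brk I (cls I x) (\<eta> u) = \<eta> (brk x u))"
      by (simp add: f i qbrk_cls[OF L I] cls_eq_iff[OF S])
    finally show ?thesis using True C by (simp add: H0_def cocycles_def)
  next
    case False
    then show ?thesis using C by (simp add: H0_def cocycles_def)
  qed
qed

lemma half_m2_cocycle:
  assumes L: "lie_algebra brk" and I: "lie_ideal brk I" and sp: "linear_splitting I \<sigma>"
    and \<eta>: "\<eta> \<in> H0 brk I"
  shows "scale_cochain I 1 (1/2) (m2 brk I \<sigma> \<eta>) \<in> cocycles brk I 1"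
proof -
  define w where "w = scale_cochain I 1 (1/2) (m2 brk I \<sigma> \<eta>)"
  have S: "subspace I" using I by (rule lie_ideal_subspace)
  note sub = subspace_add[OF S] subspace_diff[OF S] subspace_neg[OF S] subspace_scale[OF S]
  have lin: "brk a (b + c) = brk a b + brk a c" "brk (a + b) c = brk a c + brk b c"
    "brk a (r *\<^sub>R c) = r *\<^sub>R brk a c" "brk (r *\<^sub>R a) c = r *\<^sub>R brk a c" for a b c r
    using L by (auto simp: lie_algebra_def linear_iff)
  have dif: "brk a (b - c) = brk a b - brk a c" for a b c
    using L by (auto simp: lie_algebra_def linear_diff)
  have sq: "brk a a = 0" and jac: "brk a (brk b c) + brk b (brk c a) + brk c (brk a b) = 0" for a b c
    using L by (auto simp: lie_algebra_def)
  have ab: "brk a b + brk b a = 0" for a b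
    using sq[of "a + b"] sq[of a] sq[of b] by (simp only: lin(1,2)) (simp add: add.commute)
  have anti: "brk b a = - brk a b" for a b
    by (metis ab add_eq_0_iff)
  have neg: "brk a (- b) = - brk a b" for a b
    using lin(3)[of a "-1" b] by simp
  have jac': "brk (brk a b) c = brk a (brk b c) - brk b (brk a c)" for a b c
  proof -
    have "brk b (brk c a) = - brk b (brk a c)" by (metis anti neg)
    moreover have "brk c (brk a b) = - brk (brk a b) c" by (rule anti)
    ultimately have "brk a (brk b c) + - brk b (brk a c) + - brk (brk a b) c = 0"
      using jac[of a b c] by (simp only:)
    then show ?thesis by (simp add: algebra_simps)
  qed
  have i: "u \<in> I \<Longrightarrow> brk x u \<in> I" for x u using I by (auto simp: lie_ideal_def)
  have H: "\<eta> \<in> Hom_quot I" and cl: "\<And>x u. u \<in> I \<Longrightarrow> qbrk brk I (cls I x) (\<eta> u) = \<eta> (brk x u)"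
    using \<eta> by (auto simp: H0_def)
  have q: "u \<in> I \<Longrightarrow> \<eta> u \<in> quot I" for u using H by (auto simp: Hom_quot_def)
  define f where "f u = \<sigma> (\<eta> u)" for u
  have \<eta>f: "\<eta> u = cls I (f u)" if "u \<in> I" for u
    using sp q[OF that] by (simp add: linear_splitting_def f_def)
  have fadd: "f (u + v) = f u + f v" if "u \<in> I" "v \<in> I" for u v
    using H sp that q by (simp add: Hom_quot_def linear_splitting_def f_def)
  have fsc: "f (c *\<^sub>R u) = c *\<^sub>R f u" if "u \<in> I" for u c
    using H sp that q by (simp add: Hom_quot_def linear_splitting_def f_def)
  have fdif: "f (u - v) = f u - f v" if "u \<in> I" "v \<in> I" for u v
    using fadd[of u "(-1) *\<^sub>R v"] fsc[of v "-1"] that subspace_neg[OF S] by simp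
  have eq: "cls I (brk x (f u)) = \<eta> (brk x u)" if "u \<in> I" for x u
    using cl[OF that] by (simp add: \<eta>f[OF that] qbrk_cls[OF L I])
  define P where "P x u = brk x (f u) - f (brk x u)" for x u
  have PI: "P x u \<in> I" if "u \<in> I" for x u
    using eq[OF that, of x] \<eta>f[OF i[OF that]] by (simp add: cls_eq_iff[OF S] P_def)
  have pr: "pr I \<sigma> (brk x (\<sigma> (\<eta> u))) = P x u" if "u \<in> I" for x u
    using eq[OF that, of x] by (simp add: pr_def P_def f_def)
  have w: "w [x] u = cls I (- f (P x u))" if "u \<in> I" for x u
    using that
    by (simp add: w_def scale_cochain_def m2_def pr)
       (simp add: \<eta>f[OF PI] qscale_cls[OF S])
  have Padd: "P x (u + v) = P x u + P x v" "P (x + y) u = P x u + P y u"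
    and Psc: "P x (c *\<^sub>R u) = c *\<^sub>R P x u" "P (c *\<^sub>R x) u = c *\<^sub>R P x u"
    if "u \<in> I" "v \<in> I" for x y u v c
    using that i
    by (simp_all add: P_def lin fadd fsc scaleR_diff_right)
  have wH: "w [x] \<in> Hom_quot I" for x
  proof -
    have "w [x] \<in> I \<rightarrow>\<^sub>E quot I"
      using w[of _ x] by (auto simp: quot_def w_def scale_cochain_def)
    moreover have "u + v \<in> I" "c *\<^sub>R u \<in> I" if "u \<in> I" "v \<in> I" for u v c
      using that sub by auto
    ultimately show ?thesis
      by (auto simp: Hom_quot_def w cls_add[OF S] qscale_cls[OF S] Padd Psc fadd fsc PI)
  qed
  have "w \<in> cochains I 1"
    unfolding cochains_def
  proof (intro CollectI conjI allI impI ballI)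
    show "w \<in> {xs. length xs = 1} \<rightarrow>\<^sub>E Hom_quot I"
      using wH by (auto simp: PiE_iff length_Suc_conv w_def scale_cochain_def extensional_def)
    show "w (xs[j := x + y]) u = w (xs[j := x]) u + w (xs[j := y]) u"
      if "length xs = 1 \<and> j < 1" "u \<in> I" for xs j x y u
      using that by (auto simp: length_Suc_conv w cls_add[OF S] Padd fadd PI)
    show "w (xs[j := c *\<^sub>R x]) u = qscale I c (w (xs[j := x]) u)"
      if "length xs = 1 \<and> j < 1" "u \<in> I" for xs j c x u
      using that by (auto simp: length_Suc_conv w qscale_cls[OF S] Psc fsc PI)
  qed auto
  moreover have "CE_diff brk I 1 w = zero_cochain I (Suc 1)"
  proof (intro ext)
    fix xs u
    show "CE_diff brk I 1 w xs u = zero_cochain I (Suc 1) xs u"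
    proof (cases "length xs = Suc 1 \<and> u \<in> I")
      case True
      then obtain x y where xs: "xs = [x, y]" by (auto simp: length_Suc_conv)
      have u: "u \<in> I" using True by simp
      have e: "{(j, k). j < k \<and> k \<le> Suc 0} = {(0, 1)}" by auto
      have swap: "cls I (brk a (- f v)) = cls I (- f (brk a v))" if "v \<in> I" for a v
        using PI[OF that, of a] lin(3)[of a "-1" "f v"] subspace_neg[OF S, of "P a v"]
        by (simp add: cls_eq_iff[OF S] P_def)
      let ?A = "\<lambda>x y. - f (brk x (P y u)) + f (P y (brk x u))"
      have ad: "ad_Hom brk I a (w [b]) u = cls I (?A a b)" for a b
        using u i[OF u] PI[OF u]
        by (simp add: ad_Hom_def w qbrk_cls[OF L I] swap qdiff_cls[OF S])
      have "CE_diff brk I 1 w xs u = cls I (?A x y - ?A y x + f (P (brk x y) u))"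
        using u True
        by (simp add: CE_diff_def xs qsum_def e omit_def ad w qscale_cls[OF S] cls_add[OF S]
            cls_plus_self[OF S]) (simp add: algebra_simps)
      also have "?A x y - ?A y x + f (P (brk x y) u) = 
          f (- brk x (P y u) + P y (brk x u) + brk y (P x u) - P x (brk y u) + P (brk x y) u)"
      proof -
        have n: "f (- v) = - f v" if "v \<in> I" for v using fsc[OF that, of "-1"] by simp
        show ?thesis using u by (simp add: fadd fdif n i PI sub)
      qed
      also have "- brk x (P y u) + P y (brk x u) + brk y (P x u) - P x (brk y u) + P (brk x y) u = 0"
        using u by (simp add: P_def dif jac' fdif i)
      also have "f 0 = 0" using fdif[of 0 0] subspace_0[OF S] by simp
      finally show ?thesis using True by (simp add: zero_cochain_def cls_0)
    next
      case False
      then show ?thesis by (auto simp: zero_cochain_def CE_diff_def)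
    qed
  qed
  ultimately show ?thesis by (simp add: cocycles_def w_def)
qed

lemma Kur_in_cohomology:
  assumes "lie_algebra brk" "lie_ideal brk I" "linear_splitting I \<sigma>" "\<eta> \<in> H0 brk I"
  shows "Kur brk I \<sigma> \<eta> \<in> cohomology brk I 1"
  using half_m2_cocycle[OF assms] by (simp add: Kur_def cohomology_def)

end

theory Submission
  imports Defs
begin

text \<open>
  The Kuranishi class of \<open>\<eta>\<close> is the obstruction to extending \<open>\<eta>\<close> to second order, so it vanishes as
  soon as \<open>\<eta>\<close> is the velocity of a smooth curve of ideals. A class \<open>\<eta>\<close> whose Kuranishi class is not
  zero is therefore not a deformation class.

  In detail, write \<open>W t\<close> near \<open>t = 0\<close> as the graph of \<open>\<phi> t\<close> over \<open>I\<close>, with values in a complement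
  \<open>C\<close>, and let \<open>p\<close> be the projection onto \<open>I\<close> along \<open>C\<close>. A vector \<open>z\<close> of \<open>W t\<close> satisfies
  \<open>z - p z = \<phi> t (p z)\<close>. Since \<open>W t\<close> is an ideal, this applies to \<open>z = [x, u + \<phi> t u]\<close>. Let \<open>a\<close> and
  \<open>b\<close> be the first and second derivative of \<open>\<phi>\<close> at \<open>0\<close>. Because \<open>\<phi> 0 = 0\<close>, the first derivative of
  the identity at \<open>0\<close> is \<open>[x, a u] - a [x, u] = p [x, a u]\<close>, and the second one is
  \<open>[x, b u] - b [x, u] - 2 a (p [x, a u]) = p [x, b u]\<close>, which is zero modulo \<open>I\<close>
  (\<open>deformation_class_obtain_jets\<close>).

  So, modulo \<open>I\<close>, the cochain \<open>(x, u) \<mapsto> a (p [x, a u])\<close> is the coboundary of \<open>b / 2\<close>. It is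
  \<open>- m2(\<eta>, \<eta>) / 2\<close>, except that \<open>a\<close> is the lift of \<open>\<eta>\<close> which comes from the deformation,
  whereas \<open>m2\<close> is formed with the lift \<open>\<sigma> \<circ> \<eta>\<close>. The two lifts differ by a linear map
  \<open>\<delta>\<close> from \<open>I\<close> to \<open>I\<close>, and exchanging them changes the cochain by the coboundary of
  \<open>\<eta> \<circ> \<delta>\<close> (\<open>Kur_eq_0_of_jets\<close>).
\<close>

section \<open>Lie brackets\<close>

lemma lie_algebra_linear:
  assumes "lie_algebra brk"
  shows "brk x (y + z) = brk x y + brk x z" "brk x (y - z) = brk x y - brk x z"
    "brk x (c *\<^sub>R y) = c *\<^sub>R brk x y" "brk x (- y) = - brk x y"
  using assms by (auto simp: lie_algebra_def linear_add linear_diff linear_scale linear_neg)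

lemma lie_ideal_brk: "lie_ideal brk I \<Longrightarrow> u \<in> I \<Longrightarrow> brk x u \<in> I"
  by (simp add: lie_ideal_def)

section \<open>Coboundaries of degree one\<close>

text \<open>
  The condition that \<open>u \<mapsto> cls I (g u)\<close> is linear on \<open>I\<close>. Cochains are handled through vector-valued
  representatives such as \<open>g\<close>, which need not be linear themselves.
\<close>

definition linear_mod :: "'g::real_vector set \<Rightarrow> ('g \<Rightarrow> 'g) \<Rightarrow> bool" where
  "linear_mod I g \<longleftrightarrow>
     (\<forall>u\<in>I. \<forall>v\<in>I. g (u + v) - (g u + g v) \<in> I) \<and> (\<forall>c. \<forall>u\<in>I. g (c *\<^sub>R u) - c *\<^sub>R g u \<in> I)"

lemma linear_mod_add:
  assumes S: "subspace I" and "linear_mod I f" "linear_mod I g"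
  shows "linear_mod I (\<lambda>u. f u + g u)"
  unfolding linear_mod_def
proof (intro conjI ballI allI)
  fix u v assume "u \<in> I" "v \<in> I"
  then have "(f (u + v) - (f u + f v)) + (g (u + v) - (g u + g v)) \<in> I"
    using assms by (intro subspace_add[OF S]) (auto simp: linear_mod_def)
  then show "f (u + v) + g (u + v) - (f u + g u + (f v + g v)) \<in> I"
    by (simp add: algebra_simps)
next
  fix c u assume "u \<in> I"
  then have "(f (c *\<^sub>R u) - c *\<^sub>R f u) + (g (c *\<^sub>R u) - c *\<^sub>R g u) \<in> I"
    using assms by (intro subspace_add[OF S]) (auto simp: linear_mod_def)
  then show "f (c *\<^sub>R u) + g (c *\<^sub>R u) - c *\<^sub>R (f u + g u) \<in> I"
    by (simp add: algebra_simps)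
qed

lemma linear_mod_uminus:
  assumes S: "subspace I" and "linear_mod I g"
  shows "linear_mod I (\<lambda>u. - g u)"
  unfolding linear_mod_def
proof (intro conjI ballI allI)
  fix u v assume "u \<in> I" "v \<in> I"
  then have "- (g (u + v) - (g u + g v)) \<in> I"
    using assms by (intro subspace_neg[OF S]) (auto simp: linear_mod_def)
  then show "- g (u + v) - (- g u + - g v) \<in> I"
    by (simp add: algebra_simps)
next
  fix c u assume "u \<in> I"
  then have "- (g (c *\<^sub>R u) - c *\<^sub>R g u) \<in> I"
    using assms by (intro subspace_neg[OF S]) (auto simp: linear_mod_def)
  then show "- g (c *\<^sub>R u) - c *\<^sub>R (- g u) \<in> I"
    by (simp add: algebra_simps)
qed

lemma cls_linear_mod_in_Hom_quot:
  assumes S: "subspace I"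
  shows "(\<lambda>u\<in>I. cls I (g u)) \<in> Hom_quot I \<longleftrightarrow> linear_mod I g"
  using subspace_add[OF S] subspace_scale[OF S]
  by (auto simp: Hom_quot_def linear_mod_def quot_def cls_add[OF S] qscale_cls[OF S] cls_eq_iff[OF S])

text \<open>
  With two arguments in place of a list, the complex in degree one reduces to congruences modulo
  \<open>I\<close> between representatives.
\<close>

definition cochain1 :: "'g::real_vector set \<Rightarrow> ('g \<Rightarrow> 'g \<Rightarrow> 'g) \<Rightarrow> 'g list \<Rightarrow> 'g \<Rightarrow> 'g set" where
  "cochain1 I h = (\<lambda>xs\<in>{xs. length xs = 1}. \<lambda>u\<in>I. cls I (h (xs ! 0) u))"

lemma cochain1_eq_iff:
  assumes "subspace I"
  shows "cochain1 I h = cochain1 I k \<longleftrightarrow> (\<forall>x. \<forall>u\<in>I. h x u - k x u \<in> I)"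
proof
  assume *: "cochain1 I h = cochain1 I k"
  show "\<forall>x. \<forall>u\<in>I. h x u - k x u \<in> I"
  proof (intro allI ballI)
    fix x u assume "u \<in> I"
    then show "h x u - k x u \<in> I"
      using fun_cong[OF fun_cong[OF *], of "[x]" u] assms by (simp add: cochain1_def cls_eq_iff)
  qed
qed (use assms in \<open>auto simp: cochain1_def fun_eq_iff cls_eq_iff\<close>)

lemma cochains_1_obtain:
  assumes "\<theta> \<in> cochains I 1"
  obtains h where "\<theta> = cochain1 I h"
proof -
  have H: "\<theta> \<in> {xs. length xs = 1} \<rightarrow>\<^sub>E Hom_quot I"
    using assms by (simp add: cochains_def)
  have "\<exists>f. \<forall>u\<in>I. \<theta> [x] u = cls I (f u)" for x
  proof -
    have "\<theta> [x] \<in> Hom_quot I" using H by (auto simp: PiE_iff)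
    then show ?thesis using Hom_quot_obtain by metis
  qed
  then obtain h where h: "\<And>x u. u \<in> I \<Longrightarrow> \<theta> [x] u = cls I (h x u)" by metis
  have "\<theta> xs u = cochain1 I h xs u" for xs u
  proof (cases "length xs = 1")
    case True
    then obtain x where x: "xs = [x]" by (auto simp: length_Suc_conv)
    have "\<theta> [x] \<in> Hom_quot I" using H by (auto simp: PiE_iff)
    then have "\<theta> [x] u = undefined" if "u \<notin> I"
      using that by (auto simp: Hom_quot_def PiE_iff extensional_def)
    then show ?thesis using h by (auto simp: x cochain1_def)
  next
    case False
    then show ?thesis using H by (auto simp: cochain1_def PiE_iff extensional_def)
  qed
  then show ?thesis using that by blast
qed

lemma cochains_0_obtain:
  assumes S: "subspace I" and "\<omega> \<in> cochains I 0"
  obtains g where "linear_mod I g" "\<omega> = (\<lambda>xs\<in>{xs. length xs = 0}. \<lambda>u\<in>I. cls I (g u))"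
proof -
  have H: "\<omega> \<in> {xs. length xs = 0} \<rightarrow>\<^sub>E Hom_quot I"
    using assms by (simp add: cochains_def)
  then have N: "\<omega> [] \<in> Hom_quot I" by (auto simp: PiE_iff)
  then obtain g where g: "\<And>u. u \<in> I \<Longrightarrow> \<omega> [] u = cls I (g u)" using Hom_quot_obtain by blast
  have e: "\<omega> [] = (\<lambda>u\<in>I. cls I (g u))"
    using N g by (auto simp: Hom_quot_def PiE_iff extensional_def fun_eq_iff)
  have "\<omega> = (\<lambda>xs\<in>{xs. length xs = 0}. \<lambda>u\<in>I. cls I (g u))"
    using H by (auto simp: fun_eq_iff e PiE_iff extensional_def)
  with that N e cls_linear_mod_in_Hom_quot[OF S] show ?thesis by auto
qed

lemma CE_diff_0:
  assumes L: "lie_algebra brk" and I: "lie_ideal brk I"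
  shows "CE_diff brk I 0 (\<lambda>xs\<in>{xs. length xs = 0}. \<lambda>u\<in>I. cls I (g u)) =
    cochain1 I (\<lambda>x u. brk x (g u) - g (brk x u))"
proof (intro ext)
  fix xs u
  note S = lie_ideal_subspace[OF I]
  have e: "{(j, k). j < k \<and> k = (0::nat)} = {}" by auto
  show "CE_diff brk I 0 (\<lambda>xs\<in>{xs. length xs = 0}. \<lambda>u\<in>I. cls I (g u)) xs u =
    cochain1 I (\<lambda>x u. brk x (g u) - g (brk x u)) xs u"
    by (auto simp: CE_diff_def cochain1_def qsum_def e ad_Hom_def omit_def lie_ideal_brk[OF I]
        qbrk_cls[OF L I] qdiff_cls[OF S] qscale_cls[OF S] cls_plus_self[OF S])
qed

text \<open>
  This turns membership in the space of coboundaries into a congruence between vectors, the form in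
  which the Taylor coefficients of a deformation enter.
\<close>

lemma coboundaries_1_iff:
  assumes L: "lie_algebra brk" and I: "lie_ideal brk I"
  shows "cochain1 I h \<in> coboundaries brk I 1 \<longleftrightarrow>
    (\<exists>g. linear_mod I g \<and> (\<forall>x. \<forall>u\<in>I. h x u - (brk x (g u) - g (brk x u)) \<in> I))"
proof -
  note S = lie_ideal_subspace[OF I]
  have "cochain1 I h \<in> coboundaries brk I 1 \<longleftrightarrow>
      (\<exists>g. linear_mod I g \<and> cochain1 I h = cochain1 I (\<lambda>x u. brk x (g u) - g (brk x u)))"
  proof
    assume "cochain1 I h \<in> coboundaries brk I 1"
    then obtain \<omega> where \<omega>: "\<omega> \<in> cochains I 0" "cochain1 I h = CE_diff brk I 0 \<omega>"
      by (auto simp: coboundaries_def)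
    obtain g where "linear_mod I g" "\<omega> = (\<lambda>xs\<in>{xs. length xs = 0}. \<lambda>u\<in>I. cls I (g u))"
      using cochains_0_obtain[OF S \<omega>(1)] .
    with \<omega>(2) show "\<exists>g. linear_mod I g \<and>
        cochain1 I h = cochain1 I (\<lambda>x u. brk x (g u) - g (brk x u))"
      using CE_diff_0[OF L I, of g] by auto
  next
    assume "\<exists>g. linear_mod I g \<and> cochain1 I h = cochain1 I (\<lambda>x u. brk x (g u) - g (brk x u))"
    then obtain g where g: "linear_mod I g"
      "cochain1 I h = cochain1 I (\<lambda>x u. brk x (g u) - g (brk x u))" by blast
    then have "(\<lambda>xs\<in>{xs. length xs = 0}. \<lambda>u\<in>I. cls I (g u)) \<in> cochains I 0"
      using cls_linear_mod_in_Hom_quot[OF S, of g] by (auto simp: cochains_def)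
    then show "cochain1 I h \<in> coboundaries brk I 1"
      by (auto simp: coboundaries_def g(2) CE_diff_0[OF L I, symmetric])
  qed
  then show ?thesis by (simp add: cochain1_eq_iff[OF S])
qed

text \<open>
  The coboundaries are closed under sums and differences: if \<open>k\<close> is the coboundary of \<open>g\<close>, then a
  primitive of \<open>h - k\<close> becomes a primitive of \<open>h\<close> by adding \<open>g\<close>, and conversely.
\<close>

lemma coh_class_coboundary:
  assumes L: "lie_algebra brk" and I: "lie_ideal brk I"
    and w: "cochain1 I k \<in> coboundaries brk I 1"
  shows "coh_class brk I 1 (cochain1 I k) = coh_class brk I 1 (zero_cochain I 1)"
proof -
  note S = lie_ideal_subspace[OF I]
  have d: "diff_cochain I 1 (cochain1 I h) (cochain1 I k) = cochain1 I (\<lambda>x u. h x u - k x u)" for h k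
    by (auto simp: diff_cochain_def cochain1_def fun_eq_iff qdiff_cls[OF S])
  have z: "zero_cochain I 1 = cochain1 I (\<lambda>x u. 0)"
    by (auto simp: zero_cochain_def cochain1_def fun_eq_iff cls_0)
  obtain g where g: "linear_mod I g" "\<And>x u. u \<in> I \<Longrightarrow> k x u - (brk x (g u) - g (brk x u)) \<in> I"
    using w unfolding coboundaries_1_iff[OF L I] by blast
  have "cochain1 I (\<lambda>x u. h x u - k x u) \<in> coboundaries brk I 1 \<longleftrightarrow>
      cochain1 I h \<in> coboundaries brk I 1" for h
    unfolding coboundaries_1_iff[OF L I]
  proof
    assume "\<exists>g. linear_mod I g \<and>
      (\<forall>x. \<forall>u\<in>I. h x u - k x u - (brk x (g u) - g (brk x u)) \<in> I)"
    then obtain g' where g': "linear_mod I g'"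
      "\<And>x u. u \<in> I \<Longrightarrow> h x u - k x u - (brk x (g' u) - g' (brk x u)) \<in> I" by blast
    have "h x u - (brk x (g' u + g u) - (g' (brk x u) + g (brk x u))) \<in> I" if "u \<in> I" for x u
      using subspace_add[OF S g'(2)[OF that, of x] g(2)[OF that, of x]]
      by (simp add: lie_algebra_linear[OF L] algebra_simps)
    then show "\<exists>g. linear_mod I g \<and> (\<forall>x. \<forall>u\<in>I. h x u - (brk x (g u) - g (brk x u)) \<in> I)"
      using linear_mod_add[OF S g'(1) g(1)] by blast
  next
    assume "\<exists>g. linear_mod I g \<and> (\<forall>x. \<forall>u\<in>I. h x u - (brk x (g u) - g (brk x u)) \<in> I)"
    then obtain g' where g': "linear_mod I g'"
      "\<And>x u. u \<in> I \<Longrightarrow> h x u - (brk x (g' u) - g' (brk x u)) \<in> I" by blast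
    have "h x u - k x u - (brk x (g' u + - g u) - (g' (brk x u) + - g (brk x u))) \<in> I"
      if "u \<in> I" for x u
      using subspace_diff[OF S g'(2)[OF that, of x] g(2)[OF that, of x]]
      by (simp add: lie_algebra_linear[OF L] algebra_simps)
    then show "\<exists>g. linear_mod I g \<and>
      (\<forall>x. \<forall>u\<in>I. h x u - k x u - (brk x (g u) - g (brk x u)) \<in> I)"
      using linear_mod_add[OF S g'(1) linear_mod_uminus[OF S g(1)]] by blast
  qed
  then have "diff_cochain I 1 \<theta> (cochain1 I k) \<in> coboundaries brk I 1 \<longleftrightarrow>
      diff_cochain I 1 \<theta> (zero_cochain I 1) \<in> coboundaries brk I 1"
    if "\<theta> \<in> cochains I 1" for \<theta>
    using that by (elim cochains_1_obtain) (simp add: d z del: One_nat_def)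
  then show ?thesis unfolding coh_class_def by blast
qed

section \<open>Jets of a deformation\<close>

text \<open>
  The chart only says that \<open>W + C\<close> is a direct sum. The projection extracts from a vector of
  \<open>W t\<close> the point of the base over which it lies in the graph.
\<close>

lemma complementary_projection:
  assumes "complementary W C"
  obtains p where "linear p" "\<And>u. u \<in> W \<Longrightarrow> p u = u" "\<And>c. c \<in> C \<Longrightarrow> p c = 0" "range p \<subseteq> W"
proof -
  have W: "subspace W" and C: "subspace C" and WC: "W \<inter> C = {0}" and U: "W + C = UNIV"
    using assms by (auto simp: complementary_def)
  have uniq: "u = v" if "u \<in> W" "v \<in> W" "z - u \<in> C" "z - v \<in> C" for u v z
  proof -
    have "u - v \<in> W" using that W subspace_diff by blast
    moreover have "u - v \<in> C" using subspace_diff[OF C that(4) that(3)] by simp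
    ultimately have "u - v \<in> {0}" unfolding WC[symmetric] by (rule IntI)
    then show ?thesis by simp
  qed
  have "\<exists>u\<in>W. z - u \<in> C" for z
  proof -
    have "z \<in> W + C" by (simp add: U)
    then obtain u c where "u \<in> W" "c \<in> C" "z = u + c" by (rule set_plus_elim)
    then show ?thesis by (intro bexI[of _ u]) simp_all
  qed
  then obtain p where p: "\<And>z. p z \<in> W" "\<And>z. z - p z \<in> C" by metis
  have eq: "p z = u" if "u \<in> W" "z - u \<in> C" for z u
    using uniq[OF p(1) that(1) p(2) that(2)] .
  show ?thesis
  proof
    show "linear p"
    proof (rule linearI)
      show "p (x + y) = p x + p y" for x y
        using subspace_add[OF C p(2)[of x] p(2)[of y]]
        by (intro eq subspace_add[OF W] p) (simp add: algebra_simps)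
      show "p (c *\<^sub>R x) = c *\<^sub>R p x" for c x
        using subspace_scale[OF C p(2)[of x], of c]
        by (intro eq subspace_scale[OF W] p) (simp add: algebra_simps)
    qed
    show "p u = u" if "u \<in> W" for u using that C subspace_0 by (intro eq) auto
    show "p c = 0" if "c \<in> C" for c using that W subspace_0 by (intro eq) auto
    show "range p \<subseteq> W" using p by auto
  qed
qed

text \<open>
  The equation of the graph \<open>W t\<close>. It makes no reference to a parametrisation, so it can be
  differentiated along any curve of vectors \<open>z t \<in> W t\<close>.
\<close>

lemma grassmann_chart_mem:
  assumes "grassmann_chart W t0 S C \<phi>" "t \<in> S" "z \<in> W t"
    and "linear p" "\<And>u. u \<in> W t0 \<Longrightarrow> p u = u" "\<And>c. c \<in> C \<Longrightarrow> p c = 0"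
  shows "z - p z = \<phi> t (p z)"
proof -
  obtain u where "u \<in> W t0" "z = u + \<phi> t u" "\<phi> t u \<in> C"
    using assms(1-3) unfolding grassmann_chart_def by blast
  then show ?thesis using assms(4-6) by (simp add: linear_add)
qed

lemma grassmann_chart_graph:
  assumes "grassmann_chart W t0 S C \<phi>" "t \<in> S" "u \<in> W t0"
  shows "u + \<phi> t u \<in> W t"
proof -
  have "\<forall>s\<in>S. W s = {u + \<phi> s u |u. u \<in> W t0}"
    using assms(1) unfolding grassmann_chart_def by blast
  then have "W t = {u + \<phi> t u |u. u \<in> W t0}" using assms(2) by (rule bspec)
  with assms(3) show ?thesis by blast
qed

lemma grassmann_chart_base:
  assumes "grassmann_chart W t0 S C \<phi>" "u \<in> W t0"
  shows "\<phi> t0 u = 0"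
proof -
  have c: "complementary (W t0) C" and t: "t0 \<in> S"
    using assms(1) unfolding grassmann_chart_def by blast+
  obtain p where p: "linear p" "\<And>u. u \<in> W t0 \<Longrightarrow> p u = u" "\<And>c. c \<in> C \<Longrightarrow> p c = 0"
    using complementary_projection[OF c] by metis
  show ?thesis using grassmann_chart_mem[OF assms(1) t assms(2) p] p(2)[OF assms(2)] by simp
qed

text \<open>
  On a closed interval one-sided derivatives are unique, also at the endpoint \<open>0\<close>; this is why
  the domain of the chart is cut down to one.
\<close>

lemma grassmann_chart_0_interval:
  assumes "grassmann_chart W 0 S C \<phi>"
  obtains e :: real where "0 < e" "e \<le> 1" "{0..e} \<subseteq> S"
proof -
  have "openin (top_of_set {0..1}) S" "0 \<in> S"
    using assms unfolding grassmann_chart_def by blast+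
  then obtain d where d: "d > 0" "ball 0 d \<inter> {0..1} \<subseteq> S"
    unfolding openin_contains_ball by blast
  show ?thesis
    by (rule that[of "min 1 (d / 2)"]) (use d in \<open>auto simp: dist_real_def subset_iff\<close>)
qed

text \<open>
  \<open>L n\<close> is the \<open>n\<close>-th derivative of a family of linear maps \<open>L 0\<close>. The condition is the product rule,
  because the chart has to be differentiated along vectors that move with time; constant
  curves \<open>w\<close> give the plain derivatives.
\<close>

definition derivative_tower :: "real set \<Rightarrow> (nat \<Rightarrow> real \<Rightarrow> 'g::real_normed_vector \<Rightarrow> 'g) \<Rightarrow> bool" where
  "derivative_tower S L \<longleftrightarrow> (\<forall>n t. linear (L n t)) \<and>
     (\<forall>n T t w w'. T \<subseteq> S \<longrightarrow> t \<in> T \<longrightarrow> (w has_vector_derivative w') (at t within T) \<longrightarrow>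
       ((\<lambda>s. L n s (w s)) has_vector_derivative L (Suc n) t (w t) + L n t w') (at t within T))"

text \<open>
  Smoothness is only known for \<open>t \<mapsto> \<phi> t u\<close> with \<open>u\<close> fixed in \<open>W\<close>. The values on an orthonormal basis of
  \<open>W\<close> determine \<open>\<phi> t\<close> on \<open>W\<close>, and the product rule for the sum \<open>\<Sum>b. (w \<bullet> b) D b n t\<close> is that of
  finitely many products of a coordinate function and a smooth curve. The sum also extends the family
  linearly to the whole space without using the arbitrary values of \<open>\<phi>\<close> outside \<open>W\<close>.
\<close>

lemma smooth_family_obtain_tower:
  fixes W :: "'g::euclidean_space set" and \<phi> :: "real \<Rightarrow> 'g \<Rightarrow> 'g"
  assumes W: "subspace W" and lin: "\<And>t. t \<in> S \<Longrightarrow> linear (\<phi> t)"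
    and sm: "\<And>u. u \<in> W \<Longrightarrow> smooth_curve_on S (\<lambda>t. \<phi> t u)"
  obtains L :: "nat \<Rightarrow> real \<Rightarrow> 'g \<Rightarrow> 'g" where
    "derivative_tower S L" "\<And>t u. t \<in> S \<Longrightarrow> u \<in> W \<Longrightarrow> L 0 t u = \<phi> t u"
proof -
  obtain B where B: "B \<subseteq> W" "pairwise orthogonal B" "\<And>x. x \<in> B \<Longrightarrow> norm x = 1"
    "independent B" "card B = dim W" "span B = W"
    using orthonormal_basis_subspace[OF W] by blast
  have fin: "finite B" using B(4) by (rule independent_imp_finite)
  have "\<forall>b\<in>B. \<exists>D. (\<forall>t\<in>S. D 0 t = \<phi> t b) \<and>
     (\<forall>n. \<forall>t\<in>S. (D n has_vector_derivative D (Suc n) t) (at t within S))"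
    using sm B(1) unfolding smooth_curve_on_def by blast
  then obtain D where D: "\<And>b t. b \<in> B \<Longrightarrow> t \<in> S \<Longrightarrow> D b 0 t = \<phi> t b"
    "\<And>b n t. b \<in> B \<Longrightarrow> t \<in> S \<Longrightarrow> (D b n has_vector_derivative D b (Suc n) t) (at t within S)"
    by metis
  define L where "L n t w = (\<Sum>b\<in>B. (w \<bullet> b) *\<^sub>R D b n t)" for n t w
  have L_lin: "linear (L n t)" for n t
    by (rule linearI)
      (simp_all add: L_def inner_add_left scaleR_add_left sum.distrib scaleR_sum_right)
  have L_prod: "((\<lambda>s. L n s (w s)) has_vector_derivative L (Suc n) t (w t) + L n t w') (at t within T)"
    if t: "t \<in> T" "T \<subseteq> S" and w: "(w has_vector_derivative w') (at t within T)" for n t T w w'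
  proof -
    have "((\<lambda>s. (w s \<bullet> b) *\<^sub>R D b n s) has_vector_derivative
        (w t \<bullet> b) *\<^sub>R D b (Suc n) t + (w' \<bullet> b) *\<^sub>R D b n t) (at t within T)" if b: "b \<in> B" for b
    proof -
      have "((\<lambda>s. w s \<bullet> b) has_vector_derivative w' \<bullet> b) (at t within T)"
        using bounded_linear.has_vector_derivative[OF bounded_linear_inner_left w] .
      then have "((\<lambda>s. w s \<bullet> b) has_field_derivative w' \<bullet> b) (at t within T)"
        by (simp add: has_real_derivative_iff_has_vector_derivative)
      moreover have "(D b n has_vector_derivative D b (Suc n) t) (at t within T)"
        using has_vector_derivative_within_subset[OF D(2)[OF b]] t by blast
      ultimately show ?thesis by (rule has_vector_derivative_scaleR)
    qed
    then have "((\<lambda>s. \<Sum>b\<in>B. (w s \<bullet> b) *\<^sub>R D b n s) has_vector_derivative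
        (\<Sum>b\<in>B. (w t \<bullet> b) *\<^sub>R D b (Suc n) t + (w' \<bullet> b) *\<^sub>R D b n t)) (at t within T)"
      by (rule has_vector_derivative_sum)
    then show ?thesis
      by (simp add: L_def sum.distrib)
  qed
  show ?thesis
  proof
    show "derivative_tower S L"
      using L_lin L_prod unfolding derivative_tower_def by blast
    show "L 0 t u = \<phi> t u" if "t \<in> S" "u \<in> W" for t u
    proof -
      have "u = (\<Sum>b\<in>B. (u \<bullet> b) *\<^sub>R b)"
        using orthonormal_basis_expand[OF B(2,3) _ fin, of u] that B(6) by simp
      then have "\<phi> t u = \<phi> t (\<Sum>b\<in>B. (u \<bullet> b) *\<^sub>R b)" by simp
      also have "\<dots> = (\<Sum>b\<in>B. (u \<bullet> b) *\<^sub>R \<phi> t b)"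
        using lin[OF that(1)] by (simp add: linear_sum linear_scale)
      finally show ?thesis using that by (simp add: L_def D(1))
    qed
  qed
qed

text \<open>
  The linear maps \<open>a\<close> and \<open>b\<close> are the first and second derivatives at \<open>0\<close> of a smooth chart, and the
  last two conclusions are the first two derivatives of the condition that \<open>W t\<close> is an ideal.

  The velocity \<open>\<eta>\<close> may be given in another chart \<open>\<phi>'\<close>, which is only known to be differentiable at
  \<open>0\<close>. Since the curve \<open>u + \<phi>' t u\<close> lies in \<open>W t\<close>, the graph equation of the smooth chart applies to it,
  and its first derivative shows that both charts have the same velocity modulo \<open>I\<close>.
\<close>

lemma deformation_class_obtain_jets:
  fixes brk :: "'g::euclidean_space \<Rightarrow> 'g \<Rightarrow> 'g"
  assumes L: "lie_algebra brk" and I: "lie_ideal brk I" and d: "deformation_class brk I \<eta>"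
  obtains a b where "linear a" "linear b"
    "\<And>u. u \<in> I \<Longrightarrow> \<eta> u = cls I (a u)"
    "\<And>x u. u \<in> I \<Longrightarrow> brk x (a u) - a (brk x u) \<in> I"
    "\<And>x u. u \<in> I \<Longrightarrow> brk x (b u) - b (brk x u) - 2 *\<^sub>R a (brk x (a u) - a (brk x u)) \<in> I"
proof -
  note SI = lie_ideal_subspace[OF I]
  obtain W where sg: "smooth_grassmann_curve (dim I) W" and W0: "W 0 = I"
    and id: "\<And>t. t \<in> {0..1} \<Longrightarrow> lie_ideal brk (W t)" and dv: "has_derivative_at_0 W \<eta>"
    using d by (auto simp: deformation_class_def smooth_deformation_def)
  obtain S C \<phi> where ch: "grassmann_chart W 0 S C \<phi>"
    and sm: "\<And>u. u \<in> I \<Longrightarrow> smooth_curve_on S (\<lambda>t. \<phi> t u)"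
    using sg W0 by (fastforce simp: smooth_grassmann_curve_def)
  obtain S' C' \<phi>' v where ch': "grassmann_chart W 0 S' C' \<phi>'"
    and v: "\<And>u. u \<in> I \<Longrightarrow> ((\<lambda>t. \<phi>' t u) has_vector_derivative v u) (at 0 within {0..1})"
    and \<eta>: "\<eta> = (\<lambda>u\<in>I. cls I (v u))"
    using dv unfolding has_derivative_at_0_def W0 by metis
  obtain e1 where e1: "0 < e1" "e1 \<le> 1" "{0..e1} \<subseteq> S" using grassmann_chart_0_interval[OF ch] .
  obtain e2 where e2: "0 < e2" "e2 \<le> 1" "{0..e2} \<subseteq> S'" using grassmann_chart_0_interval[OF ch'] .
  define e where "e = min e1 e2"
  define T where "T = {0..e}"
  have e: "0 < e" and T: "T \<subseteq> S" "T \<subseteq> S'" "T \<subseteq> {0..1}" "0 \<in> T"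
    using e1 e2 by (auto simp: e_def T_def subset_iff)
  obtain p where p: "linear p" "\<And>u. u \<in> I \<Longrightarrow> p u = u" "\<And>c. c \<in> C \<Longrightarrow> p c = 0" "range p \<subseteq> I"
    using complementary_projection[of I C] ch W0 by (metis grassmann_chart_def)
  have lin\<phi>: "\<And>t. t \<in> S \<Longrightarrow> linear (\<phi> t)" using ch by (simp add: grassmann_chart_def)
  obtain J where tower: "derivative_tower S J"
    and J_\<phi>: "\<And>t u. t \<in> S \<Longrightarrow> u \<in> I \<Longrightarrow> J 0 t u = \<phi> t u"
    using smooth_family_obtain_tower[of I S \<phi>, OF SI lin\<phi> sm] by blast
  have J_lin: "linear (J n t)" for n t
    using tower by (simp add: derivative_tower_def)
  have JD: "((\<lambda>s. J n s (w s)) has_vector_derivative J (Suc n) t (w t) + J n t w') (at t within T)"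
    if "t \<in> T" "(w has_vector_derivative w') (at t within T)" for n t w w'
    using tower T(1) that unfolding derivative_tower_def by blast
  have J0: "J 0 0 u = 0" if "u \<in> I" for u
    using J_\<phi>[of 0 u] T grassmann_chart_base[OF ch] that W0 by auto
  have pI: "p y \<in> I" for y using p(4) by auto
  have graph: "z - p z = J 0 t (p z)" if "t \<in> T" "z \<in> W t" for z t
    using grassmann_chart_mem[OF ch _ that(2) p(1)] J_\<phi>[OF _ pI] that(1) T(1) p(2,3) W0 by auto
  have pb: "bounded_linear p" using p(1) by (simp add: linear_conv_bounded_linear)
  have uniq: "y = y'" if "t \<in> T" "(f has_vector_derivative y) (at t within T)"
    "(f' has_vector_derivative y') (at t within T)" "\<And>s. s \<in> T \<Longrightarrow> f s = f' s" for y y' t f f'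
  proof -
    have "(f has_vector_derivative y') (at t within T)"
      using has_vector_derivative_transform[OF that(1) _ that(3)] that(4) by metis
    then show ?thesis
      using that(1,2) e vector_derivative_unique_within_closed_interval[of 0 e t f y y']
      by (simp add: T_def)
  qed
  \<comment> \<open>The first derivative of the graph equation along a curve \<open>z t \<in> W t\<close>.\<close>
  have jet1: "y - p y = J 1 t (p (z t)) + J 0 t (p y)"
    if "t \<in> T" "\<And>s. s \<in> T \<Longrightarrow> z s \<in> W s" "(z has_vector_derivative y) (at t within T)" for t z y
  proof -
    have pz: "((\<lambda>s. p (z s)) has_vector_derivative p y) (at t within T)"
      using bounded_linear.has_vector_derivative[OF pb that(3)] .
    show ?thesis
      using uniq[OF that(1) has_vector_derivative_diff[OF that(3) pz] JD[OF that(1) pz, of 0]]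
        graph that(2) by simp
  qed
  have a: "cls I (v u) = cls I (J 1 0 u)" if u: "u \<in> I" for u
  proof -
    have "((\<lambda>t. \<phi>' t u) has_vector_derivative v u) (at 0 within T)"
      using has_vector_derivative_within_subset[OF v[OF u] T(3)] .
    then have d: "((\<lambda>t. u + \<phi>' t u) has_vector_derivative v u) (at 0 within T)"
      by (auto intro!: derivative_eq_intros)
    have m: "u + \<phi>' s u \<in> W s" if "s \<in> T" for s
      using grassmann_chart_graph[OF ch', of s u] that T(2) u W0 by auto
    have "u + \<phi>' 0 u = u" using grassmann_chart_base[OF ch'] u W0 by simp
    then have "v u - p (v u) = J 1 0 u"
      using jet1[OF T(4) m d] p(2)[OF u] J0[OF pI] by simp
    then have "v u - J 1 0 u = p (v u)" by (simp add: algebra_simps)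
    then show ?thesis by (simp add: cls_eq_iff[OF SI] pI)
  qed
  have bb: "bounded_linear (brk x)" for x
    using L by (simp add: lie_algebra_def linear_conv_bounded_linear)
  have jets: "brk x (J 1 0 u) - p (brk x (J 1 0 u)) = J 1 0 (brk x u)"
    "brk x (J 2 0 u) - p (brk x (J 2 0 u)) = J 2 0 (brk x u) + 2 *\<^sub>R J 1 0 (p (brk x (J 1 0 u)))"
    if u: "u \<in> I" for x u
  proof -
    define z where "z t = brk x (u + J 0 t u)" for t
    have JuD: "((\<lambda>s. J n s u) has_vector_derivative J (Suc n) t u) (at t within T)"
      if "t \<in> T" for n t
      using JD[OF that has_vector_derivative_const, of n u] linear_0[OF J_lin] by simp
    have zD: "(z has_vector_derivative brk x (J 1 t u)) (at t within T)" if "t \<in> T" for t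
      unfolding z_def
      using has_vector_derivative_add[OF has_vector_derivative_const JuD[OF that, of 0], of u]
      by (intro bounded_linear.has_vector_derivative[OF bb]) simp
    have z1D: "((\<lambda>t. brk x (J 1 t u)) has_vector_derivative brk x (J 2 0 u)) (at 0 within T)"
      using JuD[OF T(4), of 1]
      by (intro bounded_linear.has_vector_derivative[OF bb]) (simp add: numeral_2_eq_2)
    have zW: "z t \<in> W t" if "t \<in> T" for t
    proof -
      have "u + J 0 t u \<in> W t"
        using grassmann_chart_graph[OF ch, of t u] J_\<phi>[of t u] that T(1) u W0 by auto
      then show ?thesis using id[of t] that T by (auto simp: z_def lie_ideal_def)
    qed
    have z0: "z 0 = brk x u" "p (z 0) = brk x u"
      using J0[OF u] lie_ideal_brk[OF I u] p(2) by (auto simp: z_def)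
    have first: "brk x (J 1 t u) - p (brk x (J 1 t u)) =
        J 1 t (p (z t)) + J 0 t (p (brk x (J 1 t u)))" if "t \<in> T" for t
      using jet1[OF that zW zD[OF that]] by simp
    \<comment> \<open>At \<open>t = 0\<close> the terms with \<open>J 0\<close> drop out, because the chart vanishes there.\<close>
    show "brk x (J 1 0 u) - p (brk x (J 1 0 u)) = J 1 0 (brk x u)"
      using first[OF T(4)] z0 J0[OF pI] by simp
    note pD = bounded_linear.has_vector_derivative[OF pb]
    \<comment> \<open>The identity \<open>first\<close> holds on all of \<open>T\<close>, so it can be differentiated again at \<open>0\<close>.\<close>
    have "brk x (J 2 0 u) - p (brk x (J 2 0 u)) =
        (J (Suc 1) 0 (p (z 0)) + J 1 0 (p (brk x (J 1 0 u)))) +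
        (J (Suc 0) 0 (p (brk x (J 1 0 u))) + J 0 0 (p (brk x (J 2 0 u))))"
      by (rule uniq[OF T(4) has_vector_derivative_diff[OF z1D pD[OF z1D]]
          has_vector_derivative_add[OF JD[OF T(4) pD[OF zD[OF T(4)]]] JD[OF T(4) pD[OF z1D]]] first])
    then show "brk x (J 2 0 u) - p (brk x (J 2 0 u)) =
        J 2 0 (brk x u) + 2 *\<^sub>R J 1 0 (p (brk x (J 1 0 u)))"
      using z0 J0[OF pI] by (simp add: numeral_2_eq_2 scaleR_2)
  qed
  show ?thesis
  proof
    show "linear (J 1 0)" "linear (J 2 0)" by (rule J_lin)+
    show "\<eta> u = cls I (J 1 0 u)" if "u \<in> I" for u using a[OF that] that by (simp add: \<eta>)
    fix x u assume u: "u \<in> I"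
    have P: "brk x (J 1 0 u) - J 1 0 (brk x u) = p (brk x (J 1 0 u))"
      using jets(1)[OF u, of x] by (simp add: algebra_simps)
    show "brk x (J 1 0 u) - J 1 0 (brk x u) \<in> I" unfolding P by (rule pI)
    have "brk x (J 2 0 u) - J 2 0 (brk x u) - 2 *\<^sub>R J 1 0 (p (brk x (J 1 0 u))) = p (brk x (J 2 0 u))"
      using jets(2)[OF u, of x] by (simp add: algebra_simps)
    then show "brk x (J 2 0 u) - J 2 0 (brk x u) -
        2 *\<^sub>R J 1 0 (brk x (J 1 0 u) - J 1 0 (brk x u)) \<in> I"
      unfolding P by (simp add: pI)
  qed
qed

section \<open>Vanishing of the Kuranishi class\<close>

text \<open>
  Let \<open>f\<close> be the lift \<open>\<sigma> \<circ> \<eta>\<close>, so that half of \<open>m2(\<eta>, \<eta>)\<close> is represented by \<open>- f (P x u)\<close> with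
  \<open>P x u = [x, f u] - f [x, u]\<close>, and let \<open>\<delta> = f - a\<close>, which maps \<open>I\<close> to \<open>I\<close>. Replacing \<open>f\<close> by
  \<open>a\<close> in the definition of \<open>P\<close> changes \<open>P x u\<close> by \<open>[x, \<delta> u] - \<delta> [x, u]\<close>. As \<open>a\<close> commutes with the
  bracket modulo \<open>I\<close>, its value on this difference is the coboundary of \<open>a \<circ> \<delta>\<close>. What remains is
  half the coboundary of \<open>b\<close>.
\<close>

lemma Kur_eq_0_of_jets:
  assumes L: "lie_algebra brk" and I: "lie_ideal brk I" and sp: "linear_splitting I \<sigma>"
    and \<eta>: "\<eta> \<in> H0 brk I" and a: "linear a" and b: "linear b"
    and \<eta>a: "\<And>u. u \<in> I \<Longrightarrow> \<eta> u = cls I (a u)"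
    and j1: "\<And>x u. u \<in> I \<Longrightarrow> brk x (a u) - a (brk x u) \<in> I"
    and j2: "\<And>x u. u \<in> I \<Longrightarrow> brk x (b u) - b (brk x u) - 2 *\<^sub>R a (brk x (a u) - a (brk x u)) \<in> I"
  shows "Kur brk I \<sigma> \<eta> = coh_class brk I 1 (zero_cochain I 1)"
proof -
  note S = lie_ideal_subspace[OF I]
  note i = lie_ideal_brk[OF I]
  note bl = lie_algebra_linear[OF L]
  note lin = linear_add[OF a] linear_diff[OF a] linear_scale[OF a]
    linear_add[OF b] linear_diff[OF b] linear_scale[OF b]
  have H: "\<eta> \<in> Hom_quot I" using \<eta> by (simp add: H0_def)
  have q: "u \<in> I \<Longrightarrow> \<eta> u \<in> quot I" for u using H by (auto simp: Hom_quot_def)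
  define f where "f u = \<sigma> (\<eta> u)" for u
  have \<eta>f: "\<eta> u = cls I (f u)" if "u \<in> I" for u
    using sp q[OF that] by (simp add: linear_splitting_def f_def)
  have fadd: "f (u + v) = f u + f v" if "u \<in> I" "v \<in> I" for u v
    using H sp that q by (simp add: Hom_quot_def linear_splitting_def f_def)
  have fsc: "f (c *\<^sub>R u) = c *\<^sub>R f u" if "u \<in> I" for u c
    using H sp that q by (simp add: Hom_quot_def linear_splitting_def f_def)
  define \<delta> where "\<delta> u = f u - a u" for u
  have \<delta>: "\<delta> u \<in> I" if "u \<in> I" for u
    using \<eta>f[OF that] \<eta>a[OF that] cls_eq_iff[OF S, of "f u" "a u"] by (simp add: \<delta>_def)
  define P where "P x u = brk x (f u) - f (brk x u)" for x u
  have P_eq: "P x u = (brk x (a u) - a (brk x u)) + brk x (\<delta> u) - \<delta> (brk x u)" for x u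
    by (simp add: P_def \<delta>_def bl algebra_simps)
  have PI: "P x u \<in> I" if "u \<in> I" for x u
    unfolding P_eq by (rule subspace_diff[OF S subspace_add[OF S]]) (use that j1 i \<delta> in auto)
  have pr: "pr I \<sigma> (brk x (\<sigma> (\<eta> u))) = P x u" if "u \<in> I" for x u
  proof -
    have "cls I (brk x (f u)) = cls I (f (brk x u))"
      using PI[OF that, of x] by (simp add: cls_eq_iff[OF S] P_def)
    then have "\<sigma> (cls I (brk x (f u))) = \<sigma> (\<eta> (brk x u))"
      by (simp only: \<eta>f[OF i[OF that]])
    then show ?thesis by (simp only: pr_def P_def f_def)
  qed
  have w: "scale_cochain I 1 (1/2) (m2 brk I \<sigma> \<eta>) = cochain1 I (\<lambda>x u. - f (P x u))"
    by (auto simp: fun_eq_iff scale_cochain_def m2_def cochain1_def pr \<eta>f[OF PI] qscale_cls[OF S])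
  define g where "g u = - ((1/2) *\<^sub>R b u + a (\<delta> u))" for u
  have "linear_mod I g"
    using subspace_0[OF S]
    by (auto simp: linear_mod_def g_def \<delta>_def lin fadd fsc algebra_simps)
  moreover have "- f (P x u) - (brk x (g u) - g (brk x u)) \<in> I" if u: "u \<in> I" for x u
  proof -
    define Q where "Q = brk x (a u) - a (brk x u)"
    define R where "R = brk x (b u) - b (brk x u)"
    \<comment> \<open>The second-order condition, the first-order condition at \<open>\<delta> u\<close>, and the exchange of
      \<open>f\<close> for \<open>a\<close> on the outside.\<close>
    have "(1/2) *\<^sub>R (R - 2 *\<^sub>R a Q) + (brk x (a (\<delta> u)) - a (brk x (\<delta> u))) - \<delta> (P x u) \<in> I"
      unfolding Q_def R_def
      by (rule subspace_diff[OF S subspace_add[OF S subspace_scale[OF S j2[OF u]] j1[OF \<delta>[OF u]]] \<delta>[OF PI[OF u]]])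
    also have "(1/2) *\<^sub>R (R - 2 *\<^sub>R a Q) + (brk x (a (\<delta> u)) - a (brk x (\<delta> u))) - \<delta> (P x u) =
        - f (P x u) - (brk x (g u) - g (brk x u))"
    proof -
      have "f (P x u) = \<delta> (P x u) + (a Q + a (brk x (\<delta> u)) - a (\<delta> (brk x u)))"
        by (simp only: \<delta>_def[of "P x u"]) (simp add: P_eq Q_def lin)
      then show ?thesis by (simp add: g_def R_def bl algebra_simps)
    qed
    finally show ?thesis .
  qed
  ultimately have "cochain1 I (\<lambda>x u. - f (P x u)) \<in> coboundaries brk I 1"
    unfolding coboundaries_1_iff[OF L I] by blast
  then show ?thesis unfolding Kur_def w by (rule coh_class_coboundary[OF L I])
qed

theorem proposition6p2:
  fixes brk :: "'g::euclidean_space \<Rightarrow> 'g \<Rightarrow> 'g"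
    and I :: "'g set"
    and \<sigma> :: "'g set \<Rightarrow> 'g"
  assumes "lie_algebra brk"
    and "lie_ideal brk I"
    and "linear_splitting I \<sigma>"
    and "\<exists>\<eta>\<in>H0 brk I. Kur brk I \<sigma> \<eta> \<noteq> coh_class brk I 1 (zero_cochain I 1)"
  shows "\<exists>\<eta>\<in>H0 brk I. \<not> deformation_class brk I \<eta>"
proof -
  obtain \<eta> where \<eta>: "\<eta> \<in> H0 brk I" "Kur brk I \<sigma> \<eta> \<noteq> coh_class brk I 1 (zero_cochain I 1)"
    using assms(4) by blast
  have "\<not> deformation_class brk I \<eta>"
  proof
    assume "deformation_class brk I \<eta>"
    then obtain a b where "linear a" "linear b"
      "\<And>u. u \<in> I \<Longrightarrow> \<eta> u = cls I (a u)"
      "\<And>x u. u \<in> I \<Longrightarrow> brk x (a u) - a (brk x u) \<in> I"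
      "\<And>x u. u \<in> I \<Longrightarrow> brk x (b u) - b (brk x u) - 2 *\<^sub>R a (brk x (a u) - a (brk x u)) \<in> I"
      using deformation_class_obtain_jets[OF assms(1,2)] by metis
    then show False using Kur_eq_0_of_jets[OF assms(1-3) \<eta>(1)] \<eta>(2) by blast
  qed
  with \<eta>(1) show ?thesis by blast
qed

end
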